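(* There is no unary operator $\mathcal D$ on WMTS such that all of the following hold: (1) $\mathcal D(S)$ is deterministic for every WMTS $S$; (2) $S\le_m\mathcal D(S)$ for every WMTS $S$; (3) for every WMTS $S$, every deterministic WMTS $D$ and every $\varepsilon\ge0$, $d_m(S,D)\le\varepsilon$ implies $d_m(\mathcal D(S),D)\le\varepsilon$.
   Context: Fix a finite set $\Sigma$ of actions and a real discounting factor $\lambda$ with $0<\lambda<1$. Let $\mathbb I=\{[x,y] : x\in\mathbb Z\cup\{-\infty\},\ y\in\mathbb Z\cup\{\infty\},\ x\le y\}$ and $\mathbb K=\Sigma\times\mathbb I$. Order $\mathbb I$ by $[x,y]\sqsubseteq[x',y']$ iff $x'\le x$, $y\le y'$, and $\mathbb K$ by $(a,I)\sqsubseteq(a',I')$ iff $a=a'$, $I\sqsubseteq I'$. A WMTS $S=(S,s^0,\dashrightarrow,\longrightarrow)$ consists of a set of states $S$, initial state $s^0$, may- and must-relations $\dashrightarrow,\longrightarrow\subseteq S\times\mathbb K\times S$ such that every $(s,k,s')\in\longrightarrow$ has some $(s,\ell,s')\in\dashrightarrow$ with $k\sqsubseteq\ell$. $S$ is deterministic if for all $s\in S$, $a\in\Sigma$: $s\overset{(a,I_1)}{\dashrightarrow}t_1$ and $s\overset{(a,I_2)}{\dashrightarrow}t_2$ imply $I_1=I_2$, $t_1=t_2$. A modal refinement between $S_1,S_2$ is $R\subseteq S_1\times S_2$ such that for $(s_1,s_2)\in R$: every $s_1\overset{k_1}{\dashrightarrow}t_1$ is matched by some $s_2\overset{k_2}{\dashrightarrow}t_2$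 with $k_1\sqsubseteq k_2$, $(t_1,t_2)\in R$; every $s_2\overset{k_2}{\longrightarrow}t_2$ is matched by some $s_1\overset{k_1}{\longrightarrow}t_1$ with $k_1\sqsubseteq k_2$, $(t_1,t_2)\in R$. $S_1\le_m S_2$ iff such $R$ contains $(s_1^0,s_2^0)$. Label distance $d_{\mathbb K}((a_1,I_1),(a_2,I_2))=\infty$ if $a_1\ne a_2$, $d_{\mathbb K}((a,[x_1,y_1]),(a,[x_2,y_2]))=\max(x_2-x_1,y_1-y_2,0)$. Modal refinement distance: least fixed point of $d_m(s_1,s_2)=\max\{\sup_{s_1\overset{k_1}{\dashrightarrow}t_1}\inf_{s_2\overset{k_2}{\dashrightarrow}t_2}(d_{\mathbb K}(k_1,k_2)+\lambda d_m(t_1,t_2)),\ \sup_{s_2\overset{k_2}{\longrightarrow}t_2}\inf_{s_1\overset{k_1}{\longrightarrow}t_1}(d_{\mathbb K}(k_1,k_2)+\lambda d_m(t_1,t_2))\}$ ($\sup\emptyset=0$, $\inf\emptyset=\infty$), $d_m(S_1,S_2)=d_m(s_1^0,s_2^0)$. Standing assumption: all WMTS are compactly branching (for each state $s$ the sets $\{(s',k): s\overset{k}{\dashrightarrow}s'\}$, $\{(s',k): s\overset{k}{\longrightarrow}s'\}$ are compact under $((s',k),(s'',k''))\mapsto\bar d_m(s',s'')+\bar d_{\mathbb K}(k,k'')$, $\bar d$ the symmetrization $\max(d(x,y),d(y,x))$). *)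

theory Defs
  imports "HOL-Analysis.Abstract_Topology" "HOL-Library.Extended_Nonnegative_Real"
begin

typedef interval =
  "{(x :: ereal, y :: ereal).
      x \<in> insert (-\<infinity>) (range (\<lambda>n::int. ereal (of_int n))) \<and>
      y \<in> insert \<infinity> (range (\<lambda>n::int. ereal (of_int n))) \<and> x \<le> y}"
  morphisms bounds Interval
  by (rule exI[of _ "(-\<infinity>, \<infinity>)"]) simp

definition lower :: "interval \<Rightarrow> ereal" where
  "lower I = fst (bounds I)"

definition upper :: "interval \<Rightarrow> ereal" where
  "upper I = snd (bounds I)"

type_synonym 'a label = "'a \<times> interval"

definition interval_le :: "interval \<Rightarrow> interval \<Rightarrow> bool" where
  "interval_le I J \<longleftrightarrow> lower J \<le> lower I \<and> upper I \<le> upper J"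

definition label_le :: "'a label \<Rightarrow> 'a label \<Rightarrow> bool" where
  "label_le k l \<longleftrightarrow> fst k = fst l \<and> interval_le (snd k) (snd l)"

record ('a, 's) wmts =
  states :: "'s set"
  init :: 's
  may :: "('s \<times> 'a label \<times> 's) set"
  must :: "('s \<times> 'a label \<times> 's) set"

definition deterministic :: "('a, 's) wmts \<Rightarrow> bool" where
  "deterministic S \<longleftrightarrow>
     (\<forall>s \<in> states S. \<forall>a I1 I2 t1 t2.
        (s, (a, I1), t1) \<in> may S \<and> (s, (a, I2), t2) \<in> may S \<longrightarrow> I1 = I2 \<and> t1 = t2)"

definition modal_refinement_rel ::
  "('a, 's) wmts \<Rightarrow> ('a, 't) wmts \<Rightarrow> ('s \<times> 't) set \<Rightarrow> bool" where
  "modal_refinement_rel S1 S2 R \<longleftrightarrow>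
     R \<subseteq> states S1 \<times> states S2 \<and>
     (\<forall>(s1, s2) \<in> R.
        (\<forall>k1 t1. (s1, k1, t1) \<in> may S1 \<longrightarrow>
           (\<exists>k2 t2. (s2, k2, t2) \<in> may S2 \<and> label_le k1 k2 \<and> (t1, t2) \<in> R)) \<and>
        (\<forall>k2 t2. (s2, k2, t2) \<in> must S2 \<longrightarrow>
           (\<exists>k1 t1. (s1, k1, t1) \<in> must S1 \<and> label_le k1 k2 \<and> (t1, t2) \<in> R)))"

definition modal_refines :: "('a, 's) wmts \<Rightarrow> ('a, 't) wmts \<Rightarrow> bool" where
  "modal_refines S1 S2 \<longleftrightarrow> (\<exists>R. modal_refinement_rel S1 S2 R \<and> (init S1, init S2) \<in> R)"

text \<open>The positive part of \<open>u - v\<close>. The case distinction is needed because both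
  \<open>\<infinity> - \<infinity>\<close> and \<open>-\<infinity> - (-\<infinity>)\<close> evaluate to \<open>\<infinity>\<close> in type \<open>ereal\<close>, whereas equal interval bounds
  must contribute distance 0.\<close>

definition excess :: "ereal \<Rightarrow> ereal \<Rightarrow> ennreal" where
  "excess u v = (if u \<le> v then 0 else e2ennreal (u - v))"

definition label_dist :: "'a label \<Rightarrow> 'a label \<Rightarrow> ennreal" where
  "label_dist k l =
     (if fst k \<noteq> fst l then \<infinity>
      else max (excess (lower (snd l)) (lower (snd k))) (excess (upper (snd k)) (upper (snd l))))"

text \<open>In \<open>ennreal\<close>, the empty supremum is 0 and the empty infimum is \<open>\<infinity>\<close>.\<close>

definition mdist_step ::
  "real \<Rightarrow> ('a, 's) wmts \<Rightarrow> ('a, 't) wmts \<Rightarrow> ('s \<Rightarrow> 't \<Rightarrow> ennreal) \<Rightarrow> 's \<Rightarrow> 't \<Rightarrow> ennreal" where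
  "mdist_step lam S1 S2 d s1 s2 =
     max
       (SUP (k1, t1) \<in> {(k, t). (s1, k, t) \<in> may S1}.
          INF (k2, t2) \<in> {(k, t). (s2, k, t) \<in> may S2}. label_dist k1 k2 + ennreal lam * d t1 t2)
       (SUP (k2, t2) \<in> {(k, t). (s2, k, t) \<in> must S2}.
          INF (k1, t1) \<in> {(k, t). (s1, k, t) \<in> must S1}. label_dist k1 k2 + ennreal lam * d t1 t2)"

definition state_mdist ::
  "real \<Rightarrow> ('a, 's) wmts \<Rightarrow> ('a, 't) wmts \<Rightarrow> 's \<Rightarrow> 't \<Rightarrow> ennreal" where
  "state_mdist lam S1 S2 = lfp (mdist_step lam S1 S2)"

definition mdist :: "real \<Rightarrow> ('a, 's) wmts \<Rightarrow> ('a, 't) wmts \<Rightarrow> ennreal" where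
  "mdist lam S1 S2 = state_mdist lam S1 S2 (init S1) (init S2)"

lemma mono_mdist_step:
  fixes S1 :: "('a, 's) wmts" and S2 :: "('a, 't) wmts"
  shows "mono (mdist_step lam S1 S2)"
proof (intro monoI le_funI)
  fix d d' :: "'s \<Rightarrow> 't \<Rightarrow> ennreal" and s1 s2
  assume "d \<le> d'"
  then have le: "label_dist k l + ennreal lam * d x y \<le> label_dist k l + ennreal lam * d' x y"
    for k l :: "'a label" and x y
    by (intro add_left_mono mult_left_mono) (auto simp: le_fun_def)
  show "mdist_step lam S1 S2 d s1 s2 \<le> mdist_step lam S1 S2 d' s1 s2"
    unfolding mdist_step_def case_prod_unfold
    by (intro max.mono SUP_mono' INF_mono' le)
qed

lemma state_mdist_unfold: "state_mdist lam S1 S2 = mdist_step lam S1 S2 (state_mdist lam S1 S2)"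
  unfolding state_mdist_def by (rule lfp_unfold[OF mono_mdist_step])

definition symmetrize :: "('x \<Rightarrow> 'x \<Rightarrow> ennreal) \<Rightarrow> 'x \<Rightarrow> 'x \<Rightarrow> ennreal" where
  "symmetrize d x y = max (d x y) (d y x)"

text \<open>The topology induced by an extended pseudometric, on the whole type.\<close>

definition dist_topology :: "('x \<Rightarrow> 'x \<Rightarrow> ennreal) \<Rightarrow> 'x topology" where
  "dist_topology d = topology (\<lambda>U. \<forall>x \<in> U. \<exists>e>0. \<forall>y. d x y < e \<longrightarrow> y \<in> U)"

lemma openin_dist_topology:
  "openin (dist_topology d) U \<longleftrightarrow> (\<forall>x \<in> U. \<exists>e>0. \<forall>y. d x y < e \<longrightarrow> y \<in> U)"
proof -
  have "istopology (\<lambda>U. \<forall>x \<in> U. \<exists>e>0. \<forall>y. d x y < e \<longrightarrow> y \<in> U)"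
    unfolding istopology_def
  proof (intro conjI allI impI ballI)
    fix U V x
    assume "\<forall>x\<in>U. \<exists>e>0. \<forall>y. d x y < e \<longrightarrow> y \<in> U" "\<forall>x\<in>V. \<exists>e>0. \<forall>y. d x y < e \<longrightarrow> y \<in> V"
      and "x \<in> U \<inter> V"
    then obtain e f where "e > 0" "\<forall>y. d x y < e \<longrightarrow> y \<in> U" "f > 0" "\<forall>y. d x y < f \<longrightarrow> y \<in> V"
      by blast
    then show "\<exists>e>0. \<forall>y. d x y < e \<longrightarrow> y \<in> U \<inter> V"
      by (intro exI[of _ "min e f"]) auto
  next
    fix \<U> x
    assume "\<forall>U\<in>\<U>. \<forall>x\<in>U. \<exists>e>0. \<forall>y. d x y < e \<longrightarrow> y \<in> U" and "x \<in> \<Union>\<U>"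
    then show "\<exists>e>0. \<forall>y. d x y < e \<longrightarrow> y \<in> \<Union>\<U>"
      by (meson UnionE UnionI)
  qed
  then show ?thesis
    by (simp add: dist_topology_def)
qed

definition branch_dist ::
  "real \<Rightarrow> ('a, 's) wmts \<Rightarrow> 's \<times> 'a label \<Rightarrow> 's \<times> 'a label \<Rightarrow> ennreal" where
  "branch_dist lam S p q =
     symmetrize (state_mdist lam S S) (fst p) (fst q) + symmetrize label_dist (snd p) (snd q)"

definition compactly_branching :: "real \<Rightarrow> ('a, 's) wmts \<Rightarrow> bool" where
  "compactly_branching lam S \<longleftrightarrow>
     (\<forall>s \<in> states S.
        compactin (dist_topology (branch_dist lam S)) {(s', k). (s, k, s') \<in> may S} \<and>
        compactin (dist_topology (branch_dist lam S)) {(s', k). (s, k, s') \<in> must S})"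

definition is_wmts :: "real \<Rightarrow> ('a, 's) wmts \<Rightarrow> bool" where
  "is_wmts lam S \<longleftrightarrow>
     init S \<in> states S \<and>
     may S \<subseteq> states S \<times> UNIV \<times> states S \<and>
     must S \<subseteq> states S \<times> UNIV \<times> states S \<and>
     (\<forall>s k s'. (s, k, s') \<in> must S \<longrightarrow> (\<exists>l. (s, l, s') \<in> may S \<and> label_le k l)) \<and>
     compactly_branching lam S"

end

(* A deterministic D S that S refines has to merge two branches of S, and merging loses the
   correlation between successive weights. Take S with the two weight sequences 0,0 and 1,1. Both
   lie within distance 1 of the deterministic D with the single sequence 0,1, since a branch
   deviates from D only once, by 1 or by lam. But a deterministic overapproximation of S has one
   sequence of intervals, both containing 0 and 1; it deviates from D by 1 twice, so it has
   distance at least 1 + lam from D. *)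

theory Submission
  imports Defs
begin

lemma excess_mono:
  assumes "u \<le> u'" "v' \<le> v"
  shows "excess u v \<le> excess u' v'"
proof (cases "u \<le> v")
  case False
  then have "\<not> u' \<le> v'"
    using assms by (meson order_trans)
  with False assms show ?thesis
    by (simp add: excess_def e2ennreal_mono ereal_minus_mono)
qed (simp add: excess_def)

text \<open>Widening the left interval lowers its lower bound and raises its upper bound, so both
  excesses grow. This carries lower bounds from labels of \<open>S\<close> to the labels of
  \<open>\<D> S\<close> that match them.\<close>

lemma label_dist_mono_left:
  assumes "label_le k k'"
  shows "label_dist k l \<le> label_dist k' l"
  using assms unfolding label_dist_def label_le_def interval_le_def
  by (simp del: max.bounded_iff add: max.mono excess_mono)

definition point_interval :: "int \<Rightarrow> interval" where
  "point_interval n = Interval (ereal (of_int n), ereal (of_int n))"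

lemma bounds_point_interval [simp]:
  "lower (point_interval n) = ereal (of_int n)" "upper (point_interval n) = ereal (of_int n)"
  by (simp_all add: lower_def upper_def point_interval_def Interval_inverse)

lemma label_dist_point_interval:
  "label_dist (a, point_interval m) (a, point_interval n) = ennreal (of_int \<bar>m - n\<bar>)"
proof -
  \<comment> \<open>Between finite bounds \<open>excess\<close> is truncated subtraction, because
    \<open>ennreal\<close> sends negative reals to 0. The larger of the two opposite differences is
    then the absolute value.\<close>
  have "excess (ereal (of_int i)) (ereal (of_int j)) = ennreal (of_int (i - j))" for i j
    by (auto simp: excess_def e2ennreal_ereal ennreal_neg)
  then show ?thesis
    by (auto simp: label_dist_def abs_if max_def ennreal_neg)
qed

text \<open>A single good match bounds each infimum. Only the fixed point equation enters; this is
  enough below because all runs of \<open>S\<close> and \<open>D\<close> end after two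
  steps.\<close>

lemma state_mdist_leI:
  assumes "\<And>k1 t1. (s1, k1, t1) \<in> may S1 \<Longrightarrow>
      \<exists>k2 t2. (s2, k2, t2) \<in> may S2 \<and>
        label_dist k1 k2 + ennreal lam * state_mdist lam S1 S2 t1 t2 \<le> e"
    and "\<And>k2 t2. (s2, k2, t2) \<in> must S2 \<Longrightarrow>
      \<exists>k1 t1. (s1, k1, t1) \<in> must S1 \<and>
        label_dist k1 k2 + ennreal lam * state_mdist lam S1 S2 t1 t2 \<le> e"
  shows "state_mdist lam S1 S2 s1 s2 \<le> e"
  apply (subst state_mdist_unfold)
  unfolding mdist_step_def
  by (fastforce intro!: SUP_least dest: assms intro: INF_lower2)

lemma state_mdist_geI:
  assumes "(s1, k1, t1) \<in> may S1"
    and "\<And>k2 t2. (s2, k2, t2) \<in> may S2 \<Longrightarrow>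
      e \<le> label_dist k1 k2 + ennreal lam * state_mdist lam S1 S2 t1 t2"
  shows "e \<le> state_mdist lam S1 S2 s1 s2"
  apply (subst state_mdist_unfold)
  unfolding mdist_step_def
  using assms by (intro max.coboundedI1 SUP_upper2[of "(k1, t1)"]) (auto intro!: INF_greatest)

lemma topspace_dist_topology [simp]: "topspace (dist_topology d) = UNIV"
proof -
  have "openin (dist_topology d) UNIV"
    unfolding openin_dist_topology by (auto intro: exI[of _ 1])
  then show ?thesis
    using openin_subset by blast
qed

text \<open>Finite sets are compact in every topology that contains them, so nothing about
  \<open>branch_dist\<close> has to be computed.\<close>

lemma finite_imp_compactly_branching:
  fixes S :: "('a, 's) wmts"
  assumes "finite (may S)" "finite (must S)"
  shows "compactly_branching lam S"
proof -
  have "finite {(s', k). (s, k, s') \<in> T}" if "finite T" for s and T :: "('s \<times> 'a label \<times> 's) set"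
  proof (rule finite_subset)
    show "{(s', k). (s, k, s') \<in> T} \<subseteq> (\<lambda>(s, k, s'). (s', k)) ` T"
      by force
  qed (use that in simp)
  with assms show ?thesis
    by (simp add: compactly_branching_def finite_imp_compactin)
qed

theorem theorem4:
  fixes lam :: real
  assumes "0 < lam" and "lam < 1"
    and "infinite (UNIV :: 's set)" and "infinite (UNIV :: 't set)"
  shows "\<not> (\<exists>\<D> :: ('a::finite, 's) wmts \<Rightarrow> ('a, 't) wmts.
     (\<forall>S. is_wmts lam S \<longrightarrow> is_wmts lam (\<D> S)) \<and>
     (\<forall>S. is_wmts lam S \<longrightarrow> deterministic (\<D> S)) \<and>
     (\<forall>S. is_wmts lam S \<longrightarrow> modal_refines S (\<D> S)) \<and>
     (\<forall>S (D :: ('a, 't) wmts) \<epsilon> :: real.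
        is_wmts lam S \<longrightarrow> is_wmts lam D \<longrightarrow> deterministic D \<longrightarrow> 0 \<le> \<epsilon> \<longrightarrow>
        mdist lam S D \<le> ennreal \<epsilon> \<longrightarrow> mdist lam (\<D> S) D \<le> ennreal \<epsilon>))"
proof
  assume "\<exists>\<D> :: ('a::finite, 's) wmts \<Rightarrow> ('a, 't) wmts.
     (\<forall>S. is_wmts lam S \<longrightarrow> is_wmts lam (\<D> S)) \<and>
     (\<forall>S. is_wmts lam S \<longrightarrow> deterministic (\<D> S)) \<and>
     (\<forall>S. is_wmts lam S \<longrightarrow> modal_refines S (\<D> S)) \<and>
     (\<forall>S (D :: ('a, 't) wmts) \<epsilon> :: real.
        is_wmts lam S \<longrightarrow> is_wmts lam D \<longrightarrow> deterministic D \<longrightarrow> 0 \<le> \<epsilon> \<longrightarrow>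
        mdist lam S D \<le> ennreal \<epsilon> \<longrightarrow> mdist lam (\<D> S) D \<le> ennreal \<epsilon>)"
  then obtain \<D> :: "('a, 's) wmts \<Rightarrow> ('a, 't) wmts" where
    det: "\<And>S. is_wmts lam S \<Longrightarrow> deterministic (\<D> S)" and
    ref: "\<And>S. is_wmts lam S \<Longrightarrow> modal_refines S (\<D> S)" and
    opt: "\<And>S (D :: ('a, 't) wmts) \<epsilon>. \<lbrakk>is_wmts lam S; is_wmts lam D; deterministic D; 0 \<le> \<epsilon>;
            mdist lam S D \<le> ennreal \<epsilon>\<rbrakk> \<Longrightarrow> mdist lam (\<D> S) D \<le> ennreal \<epsilon>"
    by blast
  obtain f :: "nat \<Rightarrow> 's" where "inj f"
    using assms(3) by (auto simp: infinite_iff_countable_subset)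
  obtain g :: "nat \<Rightarrow> 't" where "inj g"
    using assms(4) by (auto simp: infinite_iff_countable_subset)
  note [simp] = inj_eq[OF \<open>inj f\<close>] inj_eq[OF \<open>inj g\<close>] and One_nat_def [simp del]
  \<comment> \<open>\<open>undefined\<close> serves as one arbitrary action. With a single action,
    determinism leaves at most one may-transition for it per state.\<close>
  define k where "k n = (undefined :: 'a, point_interval n)" for n
  have dist_k: "label_dist (k m) (k n) = ennreal (of_int \<bar>m - n\<bar>)" for m n
    by (simp add: k_def label_dist_point_interval)
  \<comment> \<open>The empty must-relation makes the must-halves of refinement and distance
    vacuous.\<close>
  define S where "S = \<lparr>states = UNIV, init = f 0,
    may = {(f 0, k 0, f 1), (f 0, k 1, f 2), (f 1, k 0, f 3), (f 2, k 1, f 3)}, must = {}\<rparr>"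
  define D where "D = \<lparr>states = UNIV, init = g 0,
    may = {(g 0, k 0, g 1), (g 1, k 1, g 2)}, must = {}\<rparr>"
  have S_sel: "states S = UNIV" "init S = f 0" "must S = {}"
    "may S = {(f 0, k 0, f 1), (f 0, k 1, f 2), (f 1, k 0, f 3), (f 2, k 1, f 3)}"
    by (simp_all add: S_def)
  have D_sel: "states D = UNIV" "init D = g 0" "must D = {}"
    "may D = {(g 0, k 0, g 1), (g 1, k 1, g 2)}"
    by (simp_all add: D_def)
  have S: "is_wmts lam S"
    by (simp add: is_wmts_def S_sel finite_imp_compactly_branching)
  have D: "is_wmts lam D" "deterministic D"
    by (auto simp: is_wmts_def D_sel k_def deterministic_def finite_imp_compactly_branching)
  have "mdist lam S D \<le> ennreal 1"
  proof -
    \<comment> \<open>\<open>f 3\<close> has no transitions, so both suprema are empty.\<close>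
    have d3: "state_mdist lam S D (f 3) (g 2) = 0"
      using state_mdist_leI[of "f 3" S "g 2" D lam 0] by (simp add: S_sel D_sel)
    have d1: "state_mdist lam S D (f 1) (g 1) \<le> 1"
      by (rule state_mdist_leI) (auto simp: S_sel D_sel d3 dist_k)
    have d2: "state_mdist lam S D (f 2) (g 1) = 0"
      using state_mdist_leI[of "f 2" S "g 1" D lam 0]
      by (simp add: S_sel D_sel d3 dist_k)
    \<comment> \<open>The branch through \<open>f 1\<close> deviates from \<open>D\<close> only in
      its second step, at discounted cost at most \<open>lam\<close>. The branch through
      \<open>f 2\<close> pays 1 at once and, by \<open>d2\<close>, nothing later.\<close>
    have "ennreal lam * state_mdist lam S D (f 1) (g 1) \<le> 1"
      using mult_mono[OF _ d1, of "ennreal lam" 1] assms by simp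
    then have "state_mdist lam S D (f 0) (g 0) \<le> 1"
      by (intro state_mdist_leI) (auto simp: S_sel D_sel d2 dist_k)
    then show ?thesis
      by (simp add: mdist_def S_sel D_sel)
  qed
  then have upper_bound: "mdist lam (\<D> S) D \<le> ennreal 1"
    by (rule opt[OF S D zero_le_one])
  obtain R where R: "modal_refinement_rel S (\<D> S) R" and init: "(f 0, init (\<D> S)) \<in> R"
    using ref[OF S] by (auto simp: modal_refines_def S_sel)
  \<comment> \<open>\<open>deterministic\<close> constrains only members of the state set.\<close>
  have states: "y \<in> states (\<D> S)" if "(x, y) \<in> R" for x y
    using R that by (auto simp: modal_refinement_rel_def)
  have match: "\<exists>I u. (y, (undefined, I), u) \<in> may (\<D> S) \<and>
      label_le (k n) (undefined, I) \<and> (t, u) \<in> R"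
    if "(x, y) \<in> R" "(x, k n, t) \<in> may S" for x y n t
    using R that unfolding modal_refinement_rel_def
    by (fastforce simp: label_le_def k_def)
  note det' = det[OF S, unfolded deterministic_def, rule_format]
  obtain I u where I: "(init (\<D> S), (undefined, I), u) \<in> may (\<D> S)" "(f 1, u) \<in> R"
    using match[OF init, of 0 "f 1"] by (auto simp: S_sel)
  moreover obtain I' u' where "(init (\<D> S), (undefined, I'), u') \<in> may (\<D> S)"
      "label_le (k 1) (undefined, I')" "(f 2, u') \<in> R"
    using match[OF init, of 1 "f 2"] by (auto simp: S_sel)
  \<comment> \<open>The merge: determinism gives \<open>I' = I\<close> and \<open>u' = u\<close>, so
    \<open>u\<close> is related to both \<open>f 1\<close> and \<open>f 2\<close>.\<close>
  ultimately have I1: "label_le (k 1) (undefined, I)" "(f 2, u) \<in> R"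
    using det'[OF states[OF init]] by blast+
  \<comment> \<open>Each step now follows the branch that disagrees with \<open>D\<close>:
    \<open>I\<close> contains 1 because of \<open>f 2\<close>, and \<open>J\<close> contains 0
    because of \<open>f 1\<close>, although no run of \<open>S\<close> reads 1,0.\<close>
  obtain J v where J: "(u, (undefined, J), v) \<in> may (\<D> S)" "label_le (k 0) (undefined, J)"
    using match[OF I(2), of 0 "f 3"] by (auto simp: S_sel)
  have dI: "1 \<le> label_dist (undefined, I) (k 0)"
    using label_dist_mono_left[OF I1(1), of "k 0"] by (simp add: dist_k)
  have dJ: "1 \<le> label_dist (undefined, J) (k 1)"
    using label_dist_mono_left[OF J(2), of "k 1"] by (simp add: dist_k)
  have du: "1 \<le> state_mdist lam (\<D> S) D u (g 1)"
    by (rule state_mdist_geI[OF J(1)]) (use dJ in \<open>auto simp: D_sel intro: add_increasing2\<close>)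
  \<comment> \<open>\<open>D\<close> offers only \<open>k 0\<close> to \<open>g 1\<close> as an
    answer, so the costs \<open>dI\<close> and \<open>du\<close> add up.\<close>
  have "1 + ennreal lam * 1 \<le> state_mdist lam (\<D> S) D (init (\<D> S)) (g 0)"
    by (rule state_mdist_geI[OF I(1)])
      (use dI du in \<open>auto simp: D_sel simp del: mult_1_right intro!: add_mono mult_left_mono\<close>)
  also have "\<dots> \<le> ennreal 1"
    using upper_bound by (simp add: mdist_def D_sel)
  finally have "ennreal (1 + lam) \<le> ennreal 1"
    using assms by simp
  with assms show False
    by (simp del: ennreal_1)
qed

end
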